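(* Let $X$ and $Y$ be ordered vector spaces with positive cones $X_+$ and $Y_+$. Then the projective cone $$K_p(X,Y) = \left\{ \sum_{i=1}^n x_i \otimes y_i \colon n \in \mathbb{N},\ x_i \in X_+,\ y_i \in Y_+ \right\} \subset X \otimes Y$$ is a cone in the algebraic tensor product $X \otimes Y$.
   Context: All vector spaces are real. A wedge $C$ in a vector space is a convex subset satisfying $C + C \subset C$ and $\lambda C \subset C$ for all $\lambda \geq 0$. A wedge $C$ is called a cone if $C \cap -C = \{0\}$. An ordered vector space is a vector space $X$ equipped with a partial order $\leq$ compatible with the linear structure: $x \leq y$ implies $x+z \leq y+z$ for all $z \in X$ and $\lambda x \leq \lambda y$ for all $\lambda \geq 0$. Its positive cone is $X_+ = \{x \in X \colon x \geq 0\}$. No Archimedean, generating or dimension assumption is made. $X \otimes Y$ is the algebraic tensor product over $\mathbb{R}$. *)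

theory Defs
  imports "HOL-Analysis.Analysis" "HOL-Library.Poly_Mapping"
begin

section \<open>The algebraic tensor product of real vector spaces\<close>

instantiation poly_mapping :: (type, real_vector) real_vector
begin

lift_definition scaleR_poly_mapping :: "real \<Rightarrow> ('a \<Rightarrow>\<^sub>0 'b) \<Rightarrow> 'a \<Rightarrow>\<^sub>0 'b"
  is "\<lambda>r f k. r *\<^sub>R f k"
  by (erule rev_finite_subset) auto

instance
  by standard (transfer; simp add: fun_eq_iff algebra_simps)+

end

text \<open>
  The type \<open>('a \<times> 'b) \<Rightarrow>\<^sub>0 real\<close> is the free real vector space on \<open>'a \<times> 'b\<close>, with basis
  vectors \<open>Poly_Mapping.single (x, y) 1\<close>. The tensor product is its quotient by the span of
  the bilinearity relations.
\<close>

definition tensor_relations ::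
    "(('a::real_vector \<times> 'b::real_vector) \<Rightarrow>\<^sub>0 real) set" where
  "tensor_relations =
     {Poly_Mapping.single (x + x', y) 1 - Poly_Mapping.single (x, y) 1
        - Poly_Mapping.single (x', y) 1 | x x' y. True} \<union>
     {Poly_Mapping.single (x, y + y') 1 - Poly_Mapping.single (x, y) 1
        - Poly_Mapping.single (x, y') 1 | x y y'. True} \<union>
     {Poly_Mapping.single (r *\<^sub>R x, y) 1 - r *\<^sub>R Poly_Mapping.single (x, y) 1 | r x y. True} \<union>
     {Poly_Mapping.single (x, r *\<^sub>R y) 1 - r *\<^sub>R Poly_Mapping.single (x, y) 1 | r x y. True}"

definition tensor_eq ::
    "(('a::real_vector \<times> 'b::real_vector) \<Rightarrow>\<^sub>0 real) \<Rightarrow> (('a \<times> 'b) \<Rightarrow>\<^sub>0 real) \<Rightarrow> bool" where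
  "tensor_eq f g \<longleftrightarrow> f - g \<in> span tensor_relations"

lemma equivp_tensor_eq:
  "equivp (tensor_eq :: (('a::real_vector \<times> 'b::real_vector) \<Rightarrow>\<^sub>0 real) \<Rightarrow> _)"
  (is "equivp ?E")
proof (rule equivpI)
  show "reflp ?E"
    by (auto simp: reflp_def tensor_eq_def span_zero)
  show "symp ?E"
    unfolding symp_def tensor_eq_def by (metis minus_diff_eq span_neg)
  show "transp ?E"
  proof (rule transpI)
    fix f g h :: "('a \<times> 'b) \<Rightarrow>\<^sub>0 real"
    assume "tensor_eq f g" "tensor_eq g h"
    then have "(f - g) + (g - h) \<in> span tensor_relations"
      unfolding tensor_eq_def by (rule span_add)
    then show "tensor_eq f h"
      by (simp add: tensor_eq_def)
  qed
qed

quotient_type (overloaded) ('a, 'b) tensor =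
  "('a::real_vector \<times> 'b::real_vector) \<Rightarrow>\<^sub>0 real" / tensor_eq
  by (rule equivp_tensor_eq)

instantiation tensor :: (real_vector, real_vector) real_vector
begin

lift_definition zero_tensor :: "('a, 'b) tensor" is 0 .

lift_definition plus_tensor :: "('a, 'b) tensor \<Rightarrow> ('a, 'b) tensor \<Rightarrow> ('a, 'b) tensor" is "(+)"
  unfolding tensor_eq_def add_diff_add by (rule span_add)

lift_definition uminus_tensor :: "('a, 'b) tensor \<Rightarrow> ('a, 'b) tensor" is uminus
  unfolding tensor_eq_def minus_diff_minus by (rule span_neg)

lift_definition minus_tensor :: "('a, 'b) tensor \<Rightarrow> ('a, 'b) tensor \<Rightarrow> ('a, 'b) tensor" is "(-)"
proof -
  fix f f' g g' :: "('a \<times> 'b) \<Rightarrow>\<^sub>0 real"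
  assume "tensor_eq f f'" "tensor_eq g g'"
  then have "(f - f') - (g - g') \<in> span tensor_relations"
    unfolding tensor_eq_def by (rule span_diff)
  then show "tensor_eq (f - g) (f' - g')"
    by (simp add: tensor_eq_def algebra_simps)
qed

lift_definition scaleR_tensor :: "real \<Rightarrow> ('a, 'b) tensor \<Rightarrow> ('a, 'b) tensor" is "(*\<^sub>R)"
  unfolding tensor_eq_def scaleR_right_diff_distrib[symmetric] by (rule span_scale)

instance
  by standard (transfer; simp add: tensor_eq_def span_zero algebra_simps)+

end

lift_definition tensor_elem ::
    "'a::real_vector \<Rightarrow> 'b::real_vector \<Rightarrow> ('a, 'b) tensor"  (infixl "\<otimes>\<^sub>t" 70)
  is "\<lambda>x y. Poly_Mapping.single (x, y) 1" .

lemma bilinear_tensor_elem: "bilinear (\<otimes>\<^sub>t)"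
  unfolding bilinear_def
proof (intro conjI allI linearI)
  fix x x' :: 'a and y y' :: 'b and r :: real
  show "x \<otimes>\<^sub>t (y + y') = x \<otimes>\<^sub>t y + x \<otimes>\<^sub>t y'"
    by transfer
      (unfold tensor_eq_def, rule span_base, unfold tensor_relations_def diff_diff_eq[symmetric], blast)
  show "(x + x') \<otimes>\<^sub>t y = x \<otimes>\<^sub>t y + x' \<otimes>\<^sub>t y"
    by transfer
      (unfold tensor_eq_def, rule span_base, unfold tensor_relations_def diff_diff_eq[symmetric], blast)
  show "x \<otimes>\<^sub>t (r *\<^sub>R y) = r *\<^sub>R (x \<otimes>\<^sub>t y)"
    by transfer (unfold tensor_eq_def, rule span_base, unfold tensor_relations_def, blast)
  show "(r *\<^sub>R x) \<otimes>\<^sub>t y = r *\<^sub>R (x \<otimes>\<^sub>t y)"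
    by transfer (unfold tensor_eq_def, rule span_base, unfold tensor_relations_def, blast)
qed

lemma poly_mapping_eq_sum_single:
  "f = (\<Sum>k\<in>Poly_Mapping.keys f. Poly_Mapping.lookup f k *\<^sub>R Poly_Mapping.single k (1::real))"
proof (rule poly_mapping_eqI)
  fix k
  have "(\<Sum>j\<in>Poly_Mapping.keys f. Poly_Mapping.lookup f j * (if k = j then 1 else 0)) =
      Poly_Mapping.lookup f k"
    by (simp add: if_distrib[of "\<lambda>c. _ * c"] in_keys_iff cong: if_cong)
  then show "Poly_Mapping.lookup f k = Poly_Mapping.lookup
      (\<Sum>k\<in>Poly_Mapping.keys f. Poly_Mapping.lookup f k *\<^sub>R Poly_Mapping.single k 1) k"
    by (simp add: lookup_sum scaleR_poly_mapping.rep_eq lookup_single when_def eq_commute)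
qed

lemma abs_tensor_sum: "abs_tensor (sum f A) = (\<Sum>a\<in>A. abs_tensor (f a))"
  by (induction A rule: infinite_finite_induct)
    (simp_all add: plus_tensor.abs_eq[symmetric] zero_tensor.abs_eq[symmetric])

lemma span_tensor_elem: "u \<in> span {x \<otimes>\<^sub>t y | x y. True}"
proof (induction u rule: tensor.abs_induct)
  case (1 f)
  have "abs_tensor f = abs_tensor
      (\<Sum>k\<in>Poly_Mapping.keys f. Poly_Mapping.lookup f k *\<^sub>R Poly_Mapping.single k 1)"
    by (rule arg_cong[OF poly_mapping_eq_sum_single])
  also have "\<dots> = (\<Sum>k\<in>Poly_Mapping.keys f. Poly_Mapping.lookup f k *\<^sub>R (fst k \<otimes>\<^sub>t snd k))"
    by (simp only: abs_tensor_sum scaleR_tensor.abs_eq[symmetric] tensor_elem.abs_eq prod.collapse)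
  also have "\<dots> \<in> span {x \<otimes>\<^sub>t y | x y. True}"
    by (intro span_sum span_scale span_base) blast
  finally show ?case .
qed

definition free_extension ::
    "('k \<Rightarrow> 'c::real_vector) \<Rightarrow> ('k \<Rightarrow>\<^sub>0 real) \<Rightarrow> 'c" where
  "free_extension b f = (\<Sum>k\<in>Poly_Mapping.keys f. Poly_Mapping.lookup f k *\<^sub>R b k)"

lemma free_extension_superset:
  assumes "finite S" "Poly_Mapping.keys f \<subseteq> S"
  shows "free_extension b f = (\<Sum>k\<in>S. Poly_Mapping.lookup f k *\<^sub>R b k)"
  unfolding free_extension_def using assms
  by (intro sum.mono_neutral_left) (auto simp: in_keys_iff)

lemma linear_free_extension: "linear (free_extension b)"
proof (rule linearI)
  fix f g :: "'a \<Rightarrow>\<^sub>0 real" and r :: real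
  let ?S = "Poly_Mapping.keys f \<union> Poly_Mapping.keys g"
  have "free_extension b h = (\<Sum>k\<in>?S. Poly_Mapping.lookup h k *\<^sub>R b k)"
    if "Poly_Mapping.keys h \<subseteq> ?S" for h
    using that by (intro free_extension_superset) auto
  then show "free_extension b (f + g) = free_extension b f + free_extension b g"
    by (simp add: keys_add lookup_add scaleR_left_distrib sum.distrib)
  have "Poly_Mapping.keys (r *\<^sub>R f) \<subseteq> Poly_Mapping.keys f"
    by (auto simp: in_keys_iff scaleR_poly_mapping.rep_eq)
  then have "free_extension b (r *\<^sub>R f) =
      (\<Sum>k\<in>Poly_Mapping.keys f. Poly_Mapping.lookup (r *\<^sub>R f) k *\<^sub>R b k)"
    by (intro free_extension_superset) auto
  then show "free_extension b (r *\<^sub>R f) = r *\<^sub>R free_extension b f"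
    by (simp add: free_extension_def scaleR_poly_mapping.rep_eq scaleR_sum_right)
qed

lemma free_extension_single: "free_extension b (Poly_Mapping.single k 1) = b k"
  by (simp add: free_extension_def)

theorem tensor_universal_property:
  fixes B :: "'a::real_vector \<Rightarrow> 'b::real_vector \<Rightarrow> 'c::real_vector"
  assumes "bilinear B"
  shows "\<exists>!L. linear L \<and> (\<forall>x y. L (x \<otimes>\<^sub>t y) = B x y)"
proof -
  let ?F = "free_extension (\<lambda>(x, y). B x y)"
  note linF = linear_free_extension[of "\<lambda>(x, y). B x y"]
  have "?F f = 0" if "f \<in> tensor_relations" for f
    using that
    by (auto simp: tensor_relations_def linear_diff[OF linF] linear_scale[OF linF]
      free_extension_single bilinear_ladd[OF assms] bilinear_radd[OF assms]
      bilinear_lmul[OF assms] bilinear_rmul[OF assms])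
  then have "span tensor_relations \<subseteq> {f. ?F f = 0}"
    by (intro span_minimal linear_subspace_kernel[OF linF]) auto
  then have resp: "?F f = ?F g" if "tensor_eq f g" for f g
    using that linear_diff[OF linF, of f g] by (auto simp: tensor_eq_def)
  define L where "L u = ?F (rep_tensor u)" for u
  have L_abs: "L (abs_tensor f) = ?F f" for f
    unfolding L_def by (intro resp) (rule Quotient3_rep_abs[OF Quotient3_tensor equivp_reflp[OF equivp_tensor_eq]])
  have "linear L"
  proof (rule linearI)
    fix u v :: "('a, 'b) tensor" and r :: real
    show "L (u + v) = L u + L v"
      by (induction u rule: tensor.abs_induct, induction v rule: tensor.abs_induct)
        (simp only: plus_tensor.abs_eq L_abs linear_add[OF linF])
    show "L (r *\<^sub>R u) = r *\<^sub>R L u"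
      by (induction u rule: tensor.abs_induct)
        (simp only: scaleR_tensor.abs_eq L_abs linear_scale[OF linF])
  qed
  have L_elem: "L (x \<otimes>\<^sub>t y) = B x y" for x y
    by (simp add: tensor_elem.abs_eq L_abs free_extension_single)
  show ?thesis
  proof (rule ex1I)
    show "linear L \<and> (\<forall>x y. L (x \<otimes>\<^sub>t y) = B x y)"
      using \<open>linear L\<close> L_elem by blast
  next
    fix M
    assume M: "linear M \<and> (\<forall>x y. M (x \<otimes>\<^sub>t y) = B x y)"
    show "M = L"
    proof
      fix u
      have "M v = L v" if "v \<in> {x \<otimes>\<^sub>t y | x y. True}" for v
        using that M L_elem by auto
      then show "M u = L u"
        by (rule linear_eq_on[OF conjunct1[OF M] \<open>linear L\<close> span_tensor_elem])
    qed
  qed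
qed

section \<open>Wedges, cones and the projective cone\<close>

definition wedge :: "'a::real_vector set \<Rightarrow> bool" where
  "wedge C \<longleftrightarrow> convex C \<and> (\<forall>x\<in>C. \<forall>y\<in>C. x + y \<in> C) \<and> (\<forall>r\<ge>0. \<forall>x\<in>C. r *\<^sub>R x \<in> C)"

text \<open>
  The constant \<^const>\<open>cone\<close> of \<open>HOL-Analysis\<close> only asks for closure under nonnegative
  scalars; here a cone is a wedge \<open>C\<close> with \<open>C \<inter> - C = {0}\<close>.
\<close>

definition proper_cone :: "'a::real_vector set \<Rightarrow> bool" where
  "proper_cone C \<longleftrightarrow> wedge C \<and> C \<inter> uminus ` C = {0}"

definition positive_cone :: "'a::ordered_real_vector set" where
  "positive_cone = {x. 0 \<le> x}"

definition projective_cone ::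
    "('a::ordered_real_vector, 'b::ordered_real_vector) tensor set" where
  "projective_cone =
     {\<Sum>i=1..n. x i \<otimes>\<^sub>t y i | (n::nat) x y.
        \<forall>i\<in>{1..n}. x i \<in> positive_cone \<and> y i \<in> positive_cone}"

end

theory Submission
  imports Defs
begin

text \<open>
  Finitely many strictly positive vectors of an ordered vector space admit a linear functional
  that is strictly positive on all of them. If \<open>u\<close> and \<open>- u\<close> both lie in the projective cone, take
  such functionals \<open>f\<close> and \<open>g\<close> for the nonzero left and right factors of both representations.
  Then \<open>f \<otimes> g\<close> is nonnegative at \<open>u\<close> and at \<open>- u\<close>, hence vanishes at \<open>u\<close>, which forces
  every term \<open>x \<otimes> y\<close> in the representation of \<open>u\<close> to have a zero factor.
\<close>

text \<open>Each inequality holds at \<open>e = 0\<close> and so persists for small \<open>e\<close>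
  by continuity; finitely many such conditions hold together. This allows a functional to be
  perturbed without losing strict positivity on a finite family.\<close>

lemma finite_eventually_pos_at_right_0:
  fixes a b :: "'i \<Rightarrow> real"
  assumes "finite I" "\<And>i. i \<in> I \<Longrightarrow> a i > 0"
  obtains e where "e > 0" "\<And>i. i \<in> I \<Longrightarrow> a i + e * b i > 0"
proof -
  have "\<forall>\<^sub>F e in at_right 0. 0 < a i + e * b i" if "i \<in> I" for i
  proof -
    have "((\<lambda>e. a i + e * b i) \<longlongrightarrow> a i + 0 * b i) (at_right 0)"
      by (intro tendsto_intros)
    then show ?thesis
      using assms(2)[OF that] order_tendstoD(1) by force
  qed
  then have "\<forall>\<^sub>F e in at_right 0. \<forall>i\<in>I. 0 < a i + e * b i"
    using assms(1) by (simp add: eventually_ball_finite)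
  moreover have "\<forall>\<^sub>F e in at_right 0. 0 < (e :: real)"
    by (rule eventually_at_right_less)
  ultimately have "\<forall>\<^sub>F e in at_right 0. 0 < e \<and> (\<forall>i\<in>I. 0 < a i + e * b i)"
    by eventually_elim simp
  then obtain e where "0 < e \<and> (\<forall>i\<in>I. 0 < a i + e * b i)"
    using eventually_happens[of _ "at_right (0 :: real)"] by auto
  then show thesis
    using that by blast
qed

text \<open>Induction on \<open>I\<close>: a functional \<open>f\<close> positive on the old vectors
  is kept, perturbed or replaced according to its sign at the new vector \<open>x k\<close>. The
  family is arbitrary in the induction because the negative case applies the hypothesis to shifted
  vectors.\<close>

lemma strictly_positive_functional_exists:
  fixes x :: "'i \<Rightarrow> 'a::ordered_real_vector"
  assumes "finite I" "\<And>i. i \<in> I \<Longrightarrow> x i > 0"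
  shows "\<exists>f :: 'a \<Rightarrow> real. linear f \<and> (\<forall>i\<in>I. f (x i) > 0)"
  using assms
proof (induction I arbitrary: x rule: finite_induct)
  case empty
  show ?case
    using linear_zero by auto
next
  case (insert k J)
  have xk: "x k > 0" and xJ: "\<And>j. j \<in> J \<Longrightarrow> x j > 0"
    using insert.prems by auto
  obtain f :: "'a \<Rightarrow> real" where f: "linear f" "\<And>j. j \<in> J \<Longrightarrow> f (x j) > 0"
    using insert.IH[of x] xJ by auto
  consider "f (x k) > 0" | "f (x k) = 0" | "f (x k) < 0"
    by linarith
  then show ?case
  proof cases
    case 1
    then show ?thesis
      using f by auto
  next
    case 2
    \<comment> \<open>Since \<open>x k\<close> is nonzero, some functional \<open>h\<close> has
      value 1 there. Adding a small multiple of it lifts \<open>f\<close> off 0 at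
      \<open>x k\<close>.\<close>
    have "independent {x k}"
      using xk by simp
    then obtain h :: "'a \<Rightarrow> real" where h: "linear h" "h (x k) = 1"
      using linear_independent_extend[of "{x k}" "\<lambda>_. 1 :: real"] by auto
    obtain e where e: "e > 0" "\<And>j. j \<in> J \<Longrightarrow> f (x j) + e * h (x j) > 0"
      using finite_eventually_pos_at_right_0[OF insert.hyps(1), of "\<lambda>j. f (x j)" "\<lambda>j. h (x j)"] f(2)
      by blast
    have "linear (\<lambda>v. f v + e *\<^sub>R h v)"
      by (intro linear_compose_add linear_compose_scale_right f h)
    then show ?thesis
      using e h 2 by (intro exI[of _ "\<lambda>v. f v + e *\<^sub>R h v"]) auto
  next
    case 3
    \<comment> \<open>Shift the \<open>x j\<close> along \<open>x k\<close> into the kernel of \<open>f\<close>; a functional positive on the shifted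
      vectors can then be corrected by a multiple of \<open>f\<close> to be slightly positive at \<open>x k\<close>.\<close>
    define t where "t j = - f (x j) / f (x k)" for j
    have t_pos: "t j > 0" if "j \<in> J" for j
      using f(2)[OF that] 3 by (simp add: t_def divide_pos_neg)
    \<comment> \<open>Shifting by a positive multiple of a positive vector preserves strict
      positivity, so the induction hypothesis applies to the shifted family.\<close>
    have "x j + t j *\<^sub>R x k > 0" if "j \<in> J" for j
      using xJ[OF that] t_pos[OF that] xk
      by (intro add_pos_nonneg scaleR_nonneg_nonneg) auto
    then obtain g :: "'a \<Rightarrow> real" where g: "linear g" "\<And>j. j \<in> J \<Longrightarrow> g (x j + t j *\<^sub>R x k) > 0"
      using insert.IH[of "\<lambda>j. x j + t j *\<^sub>R x k"] by auto
    have g_pos: "g (x j) + t j * g (x k) > 0" if "j \<in> J" for j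
      using g(2)[OF that] by (simp add: linear_add[OF g(1)] linear_scale[OF g(1)])
    \<comment> \<open>The functional \<open>g + s f\<close> built below keeps the values of
      \<open>g\<close> on the shifted vectors. If it equals \<open>e\<close> at \<open>x k\<close>,
      then undoing the shift costs \<open>e * t j\<close> at \<open>x j\<close>, hence the bound on
      \<open>e\<close>.\<close>
    obtain e where e: "e > 0" "\<And>j. j \<in> J \<Longrightarrow> g (x j) + t j * g (x k) + e * - t j > 0"
      using finite_eventually_pos_at_right_0[OF insert.hyps(1),
          of "\<lambda>j. g (x j) + t j * g (x k)" "\<lambda>j. - t j"] g_pos
      by blast
    \<comment> \<open>Solves \<open>g (x k) + s * f (x k) = e\<close> for \<open>s\<close>.\<close>
    define s where "s = (e - g (x k)) / f (x k)"
    have "g (x k) + s * f (x k) = e"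
      using 3 by (simp add: s_def)
    moreover have "g (x j) + s * f (x j) > 0" if "j \<in> J" for j
    proof -
      have "g (x j) + s * f (x j) = g (x j) + t j * g (x k) + e * - t j"
        using 3 by (simp add: s_def t_def field_simps)
      then show ?thesis
        using e(2)[OF that] by simp
    qed
    moreover have "linear (\<lambda>v. g v + s *\<^sub>R f v)"
      by (intro linear_compose_add linear_compose_scale_right f g)
    ultimately show ?thesis
      using e(1) by (intro exI[of _ "\<lambda>v. g v + s *\<^sub>R f v"]) auto
  qed
qed

corollary strictly_positive_functional_on_finite:
  fixes S :: "'a::ordered_real_vector set"
  assumes "finite S" "S \<subseteq> positive_cone"
  obtains f :: "'a \<Rightarrow> real"
  where "linear f" "\<And>x. x \<in> S \<Longrightarrow> f x \<ge> 0" "\<And>x. x \<in> S \<Longrightarrow> f x = 0 \<Longrightarrow> x = 0"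
proof -
  have "\<exists>f :: 'a \<Rightarrow> real. linear f \<and> (\<forall>x\<in>S - {0}. f x > 0)"
    using strictly_positive_functional_exists[of "S - {0}" "\<lambda>x. x"] assms
    by (force simp: positive_cone_def order_less_le)
  then obtain f :: "'a \<Rightarrow> real" where f: "linear f" "\<And>x. x \<in> S - {0} \<Longrightarrow> f x > 0"
    by blast
  show thesis
  proof (rule that[OF f(1)])
    fix x assume "x \<in> S"
    then show "f x \<ge> 0"
      using f(2)[of x] linear_0[OF f(1)] by (cases "x = 0") auto
    show "x = 0" if "f x = 0"
      using f(2)[of x] that \<open>x \<in> S\<close> by auto
  qed
qed

text \<open>This is the functional \<open>f \<otimes> g\<close>, obtained from the universal
  property.\<close>

lemma tensor_functional_exists:
  fixes f :: "'a::real_vector \<Rightarrow> real" and g :: "'b::real_vector \<Rightarrow> real"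
  assumes "linear f" "linear g"
  obtains L :: "('a, 'b) tensor \<Rightarrow> real"
  where "linear L" "\<And>x y. L (x \<otimes>\<^sub>t y) = f x * g y"
proof -
  have "bilinear (\<lambda>x y. f x * g y)"
    by (auto simp: bilinear_def linear_iff linear_add[OF assms(1)] linear_add[OF assms(2)]
        linear_scale[OF assms(1)] linear_scale[OF assms(2)] algebra_simps)
  then show thesis
    using tensor_universal_property that by blast
qed

lemma projective_coneI:
  fixes n :: nat
  assumes "\<And>i. i \<in> {1..n} \<Longrightarrow> x i \<in> positive_cone" "\<And>i. i \<in> {1..n} \<Longrightarrow> y i \<in> positive_cone"
  shows "(\<Sum>i=1..n. x i \<otimes>\<^sub>t y i) \<in> projective_cone"
  unfolding projective_cone_def using assms by blast

lemma projective_coneE: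
  assumes "u \<in> projective_cone"
  obtains n :: nat and x y where "u = (\<Sum>i=1..n. x i \<otimes>\<^sub>t y i)"
    "\<And>i. i \<in> {1..n} \<Longrightarrow> x i \<in> positive_cone" "\<And>i. i \<in> {1..n} \<Longrightarrow> y i \<in> positive_cone"
  using assms unfolding projective_cone_def by blast

lemma zero_in_projective_cone: "0 \<in> projective_cone"
  using projective_coneI[of 0 "\<lambda>_. 0" "\<lambda>_. 0"] by simp

lemma projective_cone_add:
  assumes "u \<in> projective_cone" "v \<in> projective_cone"
  shows "u + v \<in> projective_cone"
proof -
  from assms(1) obtain n :: nat and x y where u: "u = (\<Sum>i=1..n. x i \<otimes>\<^sub>t y i)"
    "\<And>i. i \<in> {1..n} \<Longrightarrow> x i \<in> positive_cone" "\<And>i. i \<in> {1..n} \<Longrightarrow> y i \<in> positive_cone"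
    by (rule projective_coneE) blast
  from assms(2) obtain m :: nat and x' y' where v: "v = (\<Sum>i=1..m. x' i \<otimes>\<^sub>t y' i)"
    "\<And>i. i \<in> {1..m} \<Longrightarrow> x' i \<in> positive_cone" "\<And>i. i \<in> {1..m} \<Longrightarrow> y' i \<in> positive_cone"
    by (rule projective_coneE) blast
  \<comment> \<open>The two representations are concatenated, the second one occupying the indices
    from \<open>n + 1\<close> to \<open>n + m\<close>.\<close>
  define X where "X i = (if i \<le> n then x i else x' (i - n))" for i
  define Y where "Y i = (if i \<le> n then y i else y' (i - n))" for i
  have "(\<Sum>i=n+1..n+m. X i \<otimes>\<^sub>t Y i) = (\<Sum>i=1..m. X (i + n) \<otimes>\<^sub>t Y (i + n))"
    using sum.shift_bounds_cl_nat_ivl[of "\<lambda>i. X i \<otimes>\<^sub>t Y i" 1 n m] by (simp add: add.commute)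
  also have "\<dots> = v"
    unfolding v(1) by (intro sum.cong) (auto simp: X_def Y_def)
  finally have "(\<Sum>i=n+1..n+m. X i \<otimes>\<^sub>t Y i) = v" .
  moreover have "(\<Sum>i=1..n. X i \<otimes>\<^sub>t Y i) = u"
    unfolding u(1) by (intro sum.cong) (auto simp: X_def Y_def)
  ultimately have "u + v = (\<Sum>i=1..n+m. X i \<otimes>\<^sub>t Y i)"
    using sum.ub_add_nat[of 1 n "\<lambda>i. X i \<otimes>\<^sub>t Y i" m] by simp
  also have "\<dots> \<in> projective_cone"
  proof (rule projective_coneI)
    fix i assume "i \<in> {1..n + m}"
    then consider "i \<in> {1..n}" | "i - n \<in> {1..m}" "\<not> i \<le> n"
      by fastforce
    then show "X i \<in> positive_cone" "Y i \<in> positive_cone"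
      using u(2,3) v(2,3) by (cases; simp add: X_def Y_def)+
  qed
  finally show ?thesis .
qed

lemma projective_cone_scaleR:
  assumes "u \<in> projective_cone" "r \<ge> 0"
  shows "r *\<^sub>R u \<in> projective_cone"
proof -
  from assms(1) obtain n :: nat and x y where u: "u = (\<Sum>i=1..n. x i \<otimes>\<^sub>t y i)"
    "\<And>i. i \<in> {1..n} \<Longrightarrow> x i \<in> positive_cone" "\<And>i. i \<in> {1..n} \<Longrightarrow> y i \<in> positive_cone"
    by (rule projective_coneE) blast
  \<comment> \<open>The scalar is absorbed into the left factors, which stay positive as
    \<open>r\<close> is nonnegative.\<close>
  have "r *\<^sub>R u = (\<Sum>i=1..n. (r *\<^sub>R x i) \<otimes>\<^sub>t y i)"
    by (simp add: u(1) scaleR_sum_right bilinear_lmul[OF bilinear_tensor_elem])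
  also have "\<dots> \<in> projective_cone"
    using u(2,3) assms(2)
    by (intro projective_coneI) (auto simp: positive_cone_def intro: scaleR_nonneg_nonneg)
  finally show ?thesis .
qed

lemma wedge_projective_cone: "wedge projective_cone"
  by (auto simp: wedge_def convex_def projective_cone_add projective_cone_scaleR)

lemma projective_cone_antisym:
  fixes u :: "('a::ordered_real_vector, 'b::ordered_real_vector) tensor"
  assumes "u \<in> projective_cone" "- u \<in> projective_cone"
  shows "u = 0"
proof -
  from assms(1) obtain n :: nat and x y where u: "u = (\<Sum>i=1..n. x i \<otimes>\<^sub>t y i)"
    "\<And>i. i \<in> {1..n} \<Longrightarrow> x i \<in> positive_cone" "\<And>i. i \<in> {1..n} \<Longrightarrow> y i \<in> positive_cone"
    by (rule projective_coneE) blast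
  from assms(2) obtain m :: nat and x' y' where v: "- u = (\<Sum>i=1..m. x' i \<otimes>\<^sub>t y' i)"
    "\<And>i. i \<in> {1..m} \<Longrightarrow> x' i \<in> positive_cone" "\<And>i. i \<in> {1..m} \<Longrightarrow> y' i \<in> positive_cone"
    by (rule projective_coneE) blast
  \<comment> \<open>The factors of both representations are collected so that one pair
    \<open>f\<close>, \<open>g\<close> controls the sign of \<open>L\<close> at \<open>u\<close> and
    at \<open>- u\<close> simultaneously.\<close>
  let ?S = "x ` {1..n} \<union> x' ` {1..m}" and ?T = "y ` {1..n} \<union> y' ` {1..m}"
  have S: "finite ?S" "?S \<subseteq> positive_cone" and T: "finite ?T" "?T \<subseteq> positive_cone"
    using u(2,3) v(2,3) by auto
  obtain f :: "'a \<Rightarrow> real" where f: "linear f" "\<And>x. x \<in> ?S \<Longrightarrow> f x \<ge> 0"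
    "\<And>x. x \<in> ?S \<Longrightarrow> f x = 0 \<Longrightarrow> x = 0"
    using strictly_positive_functional_on_finite[OF S] by blast
  obtain g :: "'b \<Rightarrow> real" where g: "linear g" "\<And>y. y \<in> ?T \<Longrightarrow> g y \<ge> 0"
    "\<And>y. y \<in> ?T \<Longrightarrow> g y = 0 \<Longrightarrow> y = 0"
    using strictly_positive_functional_on_finite[OF T] by blast
  obtain L :: "('a, 'b) tensor \<Rightarrow> real" where L: "linear L" "\<And>x y. L (x \<otimes>\<^sub>t y) = f x * g y"
    using tensor_functional_exists[OF f(1) g(1)] by blast
  have Lu: "L u = (\<Sum>i=1..n. f (x i) * g (y i))"
    by (simp add: u(1) linear_sum[OF L(1)] L(2))
  have terms_nonneg: "f (x i) * g (y i) \<ge> 0" if "i \<in> {1..n}" for i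
    using that f(2) g(2) by simp
  have "L (- u) = (\<Sum>i=1..m. f (x' i) * g (y' i))"
    by (simp add: v(1) linear_sum[OF L(1)] L(2))
  also have "\<dots> \<ge> 0"
    using f(2) g(2) by (intro sum_nonneg) simp
  finally have "L u \<le> 0"
    by (simp add: linear_neg[OF L(1)])
  moreover have "L u \<ge> 0"
    unfolding Lu by (intro sum_nonneg terms_nonneg)
  ultimately have "(\<Sum>i=1..n. f (x i) * g (y i)) = 0"
    using Lu by simp
  then have terms_0: "f (x i) * g (y i) = 0" if "i \<in> {1..n}" for i
    using sum_nonneg_eq_0_iff[of "{1..n}" "\<lambda>i. f (x i) * g (y i)"] terms_nonneg that by blast
  have "x i \<otimes>\<^sub>t y i = 0" if "i \<in> {1..n}" for i
  proof -
    have "x i \<in> ?S" "y i \<in> ?T"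
      using that by blast+
    then have "x i = 0 \<or> y i = 0"
      using terms_0[OF that] f(3) g(3) by (metis mult_eq_0_iff)
    then show ?thesis
      using bilinear_lzero[OF bilinear_tensor_elem] bilinear_rzero[OF bilinear_tensor_elem] by metis
  qed
  then show ?thesis
    by (simp add: u(1))
qed

theorem theorem4p8:
  shows "proper_cone
    (projective_cone :: ('a::ordered_real_vector, 'b::ordered_real_vector) tensor set)"
proof -
  have "u = 0" if "u \<in> projective_cone \<inter> uminus ` projective_cone" for u :: "('a, 'b) tensor"
    using that by (intro projective_cone_antisym) auto
  moreover have "0 \<in> uminus ` (projective_cone :: ('a, 'b) tensor set)"
    using zero_in_projective_cone by (metis image_eqI minus_zero)
  ultimately show ?thesis
    unfolding proper_cone_def using wedge_projective_cone zero_in_projective_cone by blast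
qed

end
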